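(* Let $d\ge2$ and let $\tilde{\mathbf{b}}=(\tilde b_{i,j})_{1\le i<j\le d}\in\mathbb{R}^n$ satisfy: $\tilde b_{i,j}=0$ whenever $j>i+1$; the system $F\mathbf{x}=(\tilde b_{1,2},\dots,\tilde b_{d-1,d})$ has a non-negative real solution; and $\tilde b_{i,i+1}>\tilde b_{j,j+1}$ for all $1\le i<j\le d-1$. Then the reduced Gröbner basis of $I_H$ with respect to $\tilde{\mathbf{b}}$ is $\{g_i:=\prod_{j<i}x_{j,i}-\prod_{k>i}x_{i,k}: i=2,3,\dots,d\}$ (empty products being $1$). In particular it has $d-1$ elements.
   Context: $G_d$ has vertices $1,\dots,d$ and arcs $(i,j)$, $1\le i<j\le d$; $n=\binom d2$. $F\in\mathbb{Z}^{(d-1)\times n}$ has entry $1$ in row $i$, column $(k,l)$ if $k\le i<l$, and $0$ otherwise. $H\in\mathbb{Z}^{(n-d+1)\times n}$ has rows indexed by arcs $(k,l)$ with $l>k+1$, the row of $(k,l)$ having entry $1$ in column $(k,l)$, $-1$ in columns $(j,j+1)$ for $k\le j<l$, and $0$ elsewhere. $I_H=\langle\mathbf{x}^{\mathbf{u}}-\mathbf{x}^{\mathbf{v}}:H\mathbf{u}=H\mathbf{v},\ \mathbf{u},\mathbf{v}\in\mathbb{N}^n\rangle\subseteq k[x_{i,j}]$. "With respect to $\tilde{\mathbf{b}}$" means with respect to the refinement $\succ_{\tilde{\mathbf{b}}}$ ($\mathbf{x}^{\mathbf{u}}\succ_{\tilde{\mathbf{b}}}\mathbf{x}^{\mathbf{v}}$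 iff $\tilde{\mathbf{b}}\cdot\mathbf{u}>\tilde{\mathbf{b}}\cdot\mathbf{v}$, or equality and $\mathbf{x}^{\mathbf{u}}\succ\mathbf{x}^{\mathbf{v}}$) by a term order $\succ$. *)

theory Defs
  imports Complex_Main "HOL-Library.Poly_Mapping" "HOL-Algebra.Ideal"
begin

type_synonym arc = "nat \<times> nat"
type_synonym monomial = "arc \<Rightarrow>\<^sub>0 nat"
type_synonym 'k polynomial = "monomial \<Rightarrow>\<^sub>0 'k"

definition arcs :: "nat \<Rightarrow> arc set" where
  "arcs d = {(i, j). 1 \<le> i \<and> i < j \<and> j \<le> d}"

subsection \<open>The matrices\<close>

text \<open>Matrices are indexed directly by arcs instead of by an enumeration of them. The rows of
  \<open>F_entry\<close> are \<open>1, \<dots>, d - 1\<close>, those of \<open>H_entry\<close> are \<open>H_rows d\<close>, and the columns of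
  both are \<open>arcs d\<close>; entries outside these ranges are irrelevant.\<close>

definition F_entry :: "nat \<Rightarrow> arc \<Rightarrow> int" where
  "F_entry i = (\<lambda>(k, l). if k \<le> i \<and> i < l then 1 else 0)"

definition H_rows :: "nat \<Rightarrow> arc set" where
  "H_rows d = {(k, l) \<in> arcs d. l > k + 1}"

definition H_entry :: "arc \<Rightarrow> arc \<Rightarrow> int" where
  "H_entry = (\<lambda>(k, l) e.
     if e = (k, l) then 1
     else if \<exists>j. k \<le> j \<and> j < l \<and> e = (j, j + 1) then -1
     else 0)"

subsection \<open>The polynomial ring\<close>

text \<open>The type of polynomials has a variable for every pair of natural numbers. The ring
  \<open>k[x\<^sub>i\<^sub>,\<^sub>j]\<close> for a given \<open>d\<close> is its subring of polynomials in the variables from \<open>arcs d\<close>.\<close>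

definition monomials :: "nat \<Rightarrow> monomial set" where
  "monomials d = {u. Poly_Mapping.keys u \<subseteq> arcs d}"

definition poly_ring :: "nat \<Rightarrow> ('k::field) polynomial ring" where
  "poly_ring d = \<lparr>carrier = {p. Poly_Mapping.keys p \<subseteq> monomials d},
     monoid.mult = (*), one = 1, zero = 0, add = (+)\<rparr>"

definition monom :: "monomial \<Rightarrow> ('k::field) polynomial" where
  "monom u = Poly_Mapping.single u 1"

definition var :: "arc \<Rightarrow> ('k::field) polynomial" where
  "var e = monom (Poly_Mapping.single e 1)"

definition toric_ideal :: "nat \<Rightarrow> ('k::field) polynomial set" where
  "toric_ideal d = genideal (poly_ring d)
     {monom u - monom v | u v. u \<in> monomials d \<and> v \<in> monomials d \<and>
        (\<forall>r\<in>H_rows d. (\<Sum>e\<in>arcs d. H_entry r e * int (Poly_Mapping.lookup u e)) =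
                      (\<Sum>e\<in>arcs d. H_entry r e * int (Poly_Mapping.lookup v e)))}"

subsection \<open>Term orders and Groebner bases\<close>

text \<open>An order is given by its strict ``greater'' relation: \<open>gr u v\<close> stands for
  \<open>x\<^sup>u \<succ> x\<^sup>v\<close>. Only its restriction to \<open>monomials d\<close> matters.\<close>

definition term_order :: "nat \<Rightarrow> (monomial \<Rightarrow> monomial \<Rightarrow> bool) \<Rightarrow> bool" where
  "term_order d gr \<longleftrightarrow>
     irreflp_on (monomials d) gr \<and> transp_on (monomials d) gr \<and> totalp_on (monomials d) gr \<and>
     (\<forall>u\<in>monomials d. u \<noteq> 0 \<longrightarrow> gr u 0) \<and>
     (\<forall>u\<in>monomials d. \<forall>v\<in>monomials d. \<forall>w\<in>monomials d. gr u v \<longrightarrow> gr (u + w) (v + w))"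

definition weight :: "nat \<Rightarrow> (arc \<Rightarrow> real) \<Rightarrow> monomial \<Rightarrow> real" where
  "weight d b u = (\<Sum>e\<in>arcs d. b e * real (Poly_Mapping.lookup u e))"

definition refinement ::
    "nat \<Rightarrow> (arc \<Rightarrow> real) \<Rightarrow> (monomial \<Rightarrow> monomial \<Rightarrow> bool) \<Rightarrow> monomial \<Rightarrow> monomial \<Rightarrow> bool" where
  "refinement d b gr u v \<longleftrightarrow>
     weight d b u > weight d b v \<or> (weight d b u = weight d b v \<and> gr u v)"

text \<open>Only meaningful for non-zero polynomials.\<close>

definition lead_monomial :: "(monomial \<Rightarrow> monomial \<Rightarrow> bool) \<Rightarrow> ('k::field) polynomial \<Rightarrow> monomial" where
  "lead_monomial gr f =
     (THE u. u \<in> Poly_Mapping.keys f \<and> (\<forall>v\<in>Poly_Mapping.keys f. v \<noteq> u \<longrightarrow> gr u v))"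

definition initial_ideal ::
    "nat \<Rightarrow> (monomial \<Rightarrow> monomial \<Rightarrow> bool) \<Rightarrow> ('k::field) polynomial set \<Rightarrow> 'k polynomial set" where
  "initial_ideal d gr S =
     genideal (poly_ring d) {monom (lead_monomial gr f) | f. f \<in> S \<and> f \<noteq> 0}"

definition groebner_basis ::
    "nat \<Rightarrow> (monomial \<Rightarrow> monomial \<Rightarrow> bool) \<Rightarrow> ('k::field) polynomial set \<Rightarrow> 'k polynomial set \<Rightarrow> bool" where
  "groebner_basis d gr I G \<longleftrightarrow>
     finite G \<and> G \<subseteq> I \<and> initial_ideal d gr G = initial_ideal d gr I"

definition reduced_groebner_basis ::
    "nat \<Rightarrow> (monomial \<Rightarrow> monomial \<Rightarrow> bool) \<Rightarrow> ('k::field) polynomial set \<Rightarrow> 'k polynomial set \<Rightarrow> bool" where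
  "reduced_groebner_basis d gr I G \<longleftrightarrow>
     groebner_basis d gr I G \<and>
     (\<forall>g\<in>G. g \<noteq> 0 \<and> Poly_Mapping.lookup g (lead_monomial gr g) = 1) \<and>
     (\<forall>g\<in>G. \<forall>g'\<in>G. g \<noteq> g' \<longrightarrow> (\<forall>v\<in>Poly_Mapping.keys g'. \<nexists>w. v = lead_monomial gr g + w))"

definition g_poly :: "nat \<Rightarrow> nat \<Rightarrow> ('k::field) polynomial" where
  "g_poly d i = (\<Prod>j\<in>{1..<i}. var (j, i)) - (\<Prod>k\<in>{i<..d}. var (i, k))"

end

(* Two monomials u, v agree under H iff u - v is a potential difference p k - p j on every arc
   (j, k), normalised by p 1 = 0. The coefficients of a polynomial of I_H sum to zero over every
   fiber of H, so its leading monomial u has a smaller partner v in the same fiber. If p is positive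
   somewhere, then at the first vertex i where p is maximal all entering arcs occur in u, so the
   leading monomial of g_i divides u. Otherwise p <= 0, and the monotonicity of the weights and
   summation by parts force u to divide v, contradicting that u is greater. *)

theory Submission
  imports Defs "HOL-Library.Function_Algebras"
begin

text \<open>The ideal is given by generators, so a statement about all its members must survive
  multiplication by arbitrary polynomials. Vanishing of every fiber sum does: multiplication by a
  monomial only translates the fibers. This supplies the partner of a leading monomial without
  writing a member as a combination of generators, and the Groebner property is then checked
  directly on leading monomials, with no S-pairs. The non-negative solution of
  \<open>F x = b\<close> enters as non-negativity of the weights. This makes the refinement a term
  order and gives the boundary term at \<open>d\<close> in the summation by parts its sign. The
  divisibility statement covers any two comparable monomials of a fiber, so it also identifies the
  leading monomial of \<open>g_poly d i\<close>: were the outgoing product the greater one, some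
  \<open>in_exp k\<close> would divide it, but the arc \<open>(1, k)\<close> does not leave
  \<open>i \<ge> 2\<close>. Since the claim is an equivalence in \<open>G\<close>, the uniqueness of
  reduced Groebner bases is established as well.\<close>

section \<open>Coefficient sums over the fibers of a grading\<close>

text \<open>Induction over arbitrary sums of terms, suited to properties that are additive in the
  polynomial.\<close>

lemma poly_mapping_single_induct [case_names zero single add]:
  fixes f :: "'a \<Rightarrow>\<^sub>0 'b::comm_monoid_add"
  assumes "P 0"
    and "\<And>a c. P (Poly_Mapping.single a c)"
    and "\<And>f g. P f \<Longrightarrow> P g \<Longrightarrow> P (f + g)"
  shows "P f"
proof (induction f rule: update_induct)
  case const
  then show ?case by (rule assms(1))
next
  case (update f a c)
  have "Poly_Mapping.update a c f = Poly_Mapping.single a c + f"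
    using update(1)
    by (intro poly_mapping_eqI) (auto simp: lookup_update lookup_add lookup_single in_keys_iff)
  then show ?case
    using assms(2,3) update.IH by simp
qed

definition fiber_sum :: "('a \<Rightarrow> 'c) \<Rightarrow> 'c \<Rightarrow> ('a \<Rightarrow>\<^sub>0 'b::comm_monoid_add) \<Rightarrow> 'b" where
  "fiber_sum h c f =
     (\<Sum>u\<in>Poly_Mapping.keys f. if h u = c then Poly_Mapping.lookup f u else 0)"

lemma fiber_sum_superset:
  assumes "finite A" "Poly_Mapping.keys f \<subseteq> A"
  shows "fiber_sum h c f = (\<Sum>u\<in>A. if h u = c then Poly_Mapping.lookup f u else 0)"
  unfolding fiber_sum_def
  by (rule sum.mono_neutral_left) (use assms in \<open>auto simp: in_keys_iff\<close>)

lemma fiber_sum_zero [simp]: "fiber_sum h c 0 = 0"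
  by (simp add: fiber_sum_def)

lemma fiber_sum_single [simp]:
  "fiber_sum h c (Poly_Mapping.single u a) = (if h u = c then a else 0)"
  by (simp add: fiber_sum_def)

lemma fiber_sum_add: "fiber_sum h c (f + g) = fiber_sum h c f + fiber_sum h c g"
proof -
  let ?A = "Poly_Mapping.keys f \<union> Poly_Mapping.keys g"
  have "fiber_sum h c (f + g) =
      (\<Sum>u\<in>?A. if h u = c then Poly_Mapping.lookup (f + g) u else 0)"
    by (rule fiber_sum_superset) (use keys_add[of f g] in auto)
  also have "\<dots> = fiber_sum h c f + fiber_sum h c g"
    unfolding fiber_sum_superset[of ?A f h c, simplified] fiber_sum_superset[of ?A g h c, simplified]
    by (auto simp: lookup_add simp flip: sum.distrib intro!: sum.cong)
  finally show ?thesis .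
qed

lemma fiber_sum_diff:
  fixes f g :: "'a \<Rightarrow>\<^sub>0 'b::ab_group_add"
  shows "fiber_sum h c (f - g) = fiber_sum h c f - fiber_sum h c g"
  using fiber_sum_add[of h c "f - g" g] by simp

text \<open>Multiplication by one term translates fibers by \<open>h w\<close>; the grading takes
  values in a group so that the translation can be undone by \<open>c - h w\<close>.\<close>

lemma fiber_sum_single_mult:
  fixes h :: "'a::comm_monoid_add \<Rightarrow> 'c::ab_group_add" and f :: "'a \<Rightarrow>\<^sub>0 'b::comm_semiring_1"
  assumes "\<And>u v. h (u + v) = h u + h v"
  shows "fiber_sum h c (Poly_Mapping.single w a * f) = a * fiber_sum h (c - h w) f"
proof (induction f rule: poly_mapping_single_induct)
  case (single u x)
  then show ?case
    by (auto simp: mult_single assms algebra_simps)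
qed (simp_all add: fiber_sum_add distrib_left)

text \<open>Each term of \<open>g\<close> refers to a different translate of the fiber, hence the
  vanishing of \<open>f\<close> on all fibers at once.\<close>

lemma fiber_sum_mult_eq_0:
  fixes h :: "'a::comm_monoid_add \<Rightarrow> 'c::ab_group_add" and f g :: "'a \<Rightarrow>\<^sub>0 'b::comm_semiring_1"
  assumes "\<And>u v. h (u + v) = h u + h v" and "\<And>c. fiber_sum h c f = 0"
  shows "fiber_sum h c (g * f) = 0"
  by (induction g rule: poly_mapping_single_induct)
    (simp_all add: fiber_sum_single_mult assms fiber_sum_add distrib_right)

text \<open>If \<open>u\<close> were alone in its fiber, the sum would be its coefficient, which is
  nonzero.\<close>

lemma fiber_sum_eq_0_partner:
  fixes f :: "'a \<Rightarrow>\<^sub>0 'b::comm_monoid_add"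
  assumes "fiber_sum h (h u) f = 0" "u \<in> Poly_Mapping.keys f"
  obtains v where "v \<in> Poly_Mapping.keys f" "v \<noteq> u" "h v = h u"
proof (rule ccontr)
  assume "\<not> thesis"
  with that have "h v \<noteq> h u" if "v \<in> Poly_Mapping.keys f - {u}" for v
    using that by blast
  then have "fiber_sum h (h u) f = Poly_Mapping.lookup f u"
    unfolding fiber_sum_def using assms(2)
    by (subst sum.remove[of _ u]) (auto intro!: sum.neutral)
  with assms show False
    by (simp add: in_keys_iff)
qed

section \<open>The polynomial ring and its monomial ideals\<close>

lemma monomials_zero [simp]: "0 \<in> monomials d"
  by (simp add: monomials_def)

lemma monomials_add: "u \<in> monomials d \<Longrightarrow> v \<in> monomials d \<Longrightarrow> u + v \<in> monomials d"
  using keys_add[of u v] by (auto simp: monomials_def)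

lemma monomials_addD:
  assumes "u + v \<in> monomials d"
  shows "u \<in> monomials d" "v \<in> monomials d"
  using assms by (auto simp: monomials_def in_keys_iff lookup_add subset_iff)

lemma keys_monom [simp]: "Poly_Mapping.keys (monom u :: 'k::field polynomial) = {u}"
  by (simp add: monom_def)

lemma monom_add: "monom (u + v) = (monom u * monom v :: 'k::field polynomial)"
  by (simp add: monom_def mult_single)

lemma carrier_poly_ring: "f \<in> carrier (poly_ring d) \<longleftrightarrow> Poly_Mapping.keys f \<subseteq> monomials d"
  by (simp add: poly_ring_def)

lemma poly_ring_simps [simp]:
  "mult (poly_ring d) = (*)" "add (poly_ring d) = (+)"
  "one (poly_ring d) = 1" "zero (poly_ring d) = 0"
  by (simp_all add: poly_ring_def)

lemma add_closed_poly_ring: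
  "f \<in> carrier (poly_ring d) \<Longrightarrow> g \<in> carrier (poly_ring d) \<Longrightarrow> f + g \<in> carrier (poly_ring d)"
  using keys_add[of f g] by (auto simp: carrier_poly_ring)

lemma mult_closed_poly_ring:
  "f \<in> carrier (poly_ring d) \<Longrightarrow> g \<in> carrier (poly_ring d) \<Longrightarrow> f * g \<in> carrier (poly_ring d)"
  using keys_mult[of f g] monomials_add by (fastforce simp: carrier_poly_ring)

lemma uminus_closed_poly_ring:
  "f \<in> carrier (poly_ring d) \<Longrightarrow> - f \<in> carrier (poly_ring d)"
  by (simp add: carrier_poly_ring)

lemma monom_closed_poly_ring: "monom u \<in> carrier (poly_ring d) \<longleftrightarrow> u \<in> monomials d"
  by (simp add: carrier_poly_ring)

lemma cring_poly_ring: "cring (poly_ring d :: 'k::field polynomial ring)"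
proof (rule cringI)
  show "abelian_group (poly_ring d :: 'k polynomial ring)"
  proof (rule abelian_groupI)
    show "\<exists>g\<in>carrier (poly_ring d). g \<oplus>\<^bsub>poly_ring d\<^esub> f = \<zero>\<^bsub>poly_ring d\<^esub>"
      if "f \<in> carrier (poly_ring d)" for f :: "'k polynomial"
      using that by (intro bexI[of _ "- f"]) (simp_all add: uminus_closed_poly_ring)
  qed (simp_all add: add_closed_poly_ring algebra_simps, simp add: carrier_poly_ring)
  show "comm_monoid (poly_ring d :: 'k polynomial ring)"
    by unfold_locales
      (simp_all add: mult_closed_poly_ring algebra_simps, simp add: carrier_poly_ring)
qed (simp add: algebra_simps)

lemma ring_poly_ring: "ring (poly_ring d :: 'k::field polynomial ring)"
  using cring_poly_ring by (rule cring.axioms(1))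

text \<open>Negatives come from absorption, as \<open>- f = - 1 * f\<close>.\<close>

lemma ideal_poly_ringI:
  fixes I :: "'k::field polynomial set"
  assumes "I \<subseteq> carrier (poly_ring d)" "0 \<in> I"
    and "\<And>f g. f \<in> I \<Longrightarrow> g \<in> I \<Longrightarrow> f + g \<in> I"
    and "\<And>f g. f \<in> I \<Longrightarrow> g \<in> carrier (poly_ring d) \<Longrightarrow> g * f \<in> I"
  shows "ideal I (poly_ring d)"
proof (rule idealI[OF ring_poly_ring])
  interpret R: cring "poly_ring d :: 'k polynomial ring"
    by (rule cring_poly_ring)
  show "subgroup I (add_monoid (poly_ring d))"
  proof (rule R.add.subgroupI)
    fix f assume f: "f \<in> I"
    then have fc: "f \<in> carrier (poly_ring d)"
      using assms(1) by blast
    have "\<ominus>\<^bsub>poly_ring d\<^esub> f = - f"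
      using R.add.inv_equality[of "- f" f] fc by (simp add: uminus_closed_poly_ring)
    moreover have "- 1 * f \<in> I"
      using assms(4)[OF f uminus_closed_poly_ring[of 1]] R.one_closed by simp
    ultimately show "\<ominus>\<^bsub>poly_ring d\<^esub> f \<in> I"
      by simp
  qed (use assms in auto)
  show "g \<otimes>\<^bsub>poly_ring d\<^esub> f \<in> I" if "f \<in> I" "g \<in> carrier (poly_ring d)" for f g
    using assms(4) that by simp
  then show "f \<otimes>\<^bsub>poly_ring d\<^esub> g \<in> I" if "f \<in> I" "g \<in> carrier (poly_ring d)" for f g
    using that by (simp add: mult.commute)
qed

lemma ideal_poly_ring_diff:
  fixes I :: "'k::field polynomial set"
  assumes "ideal I (poly_ring d)" "f \<in> I" "g \<in> I"
  shows "f - g \<in> I"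
proof -
  interpret I: ideal I "poly_ring d"
    by (rule assms(1))
  have "- 1 * g \<in> I"
    using I.I_l_closed[OF assms(3) uminus_closed_poly_ring[OF I.one_closed]]
    by simp
  then show ?thesis
    using additive_subgroup.a_closed[OF I.additive_subgroup_axioms assms(2), of "- g"] by simp
qed

text \<open>The polynomials all of whose monomials are multiples of members of \<open>S\<close> form
  an ideal containing the generators, so by minimality they contain the generated ideal.\<close>

lemma monomial_ideal_divides:
  assumes "f \<in> genideal (poly_ring d) (monom ` S :: 'k::field polynomial set)"
    and "S \<subseteq> monomials d" "u \<in> Poly_Mapping.keys f"
  shows "\<exists>s\<in>S. \<exists>w. u = s + w"
proof -
  let ?J = "{f :: 'k polynomial. f \<in> carrier (poly_ring d) \<and>
    (\<forall>u\<in>Poly_Mapping.keys f. \<exists>s\<in>S. \<exists>w. u = s + w)}"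
  have "ideal ?J (poly_ring d)"
  proof (rule ideal_poly_ringI)
    fix f g :: "'k polynomial"
    assume f: "f \<in> ?J"
    show "f + g \<in> ?J" if "g \<in> ?J"
      using f that keys_add[of f g] by (auto simp: add_closed_poly_ring)
    assume g: "g \<in> carrier (poly_ring d)"
    have "\<exists>s\<in>S. \<exists>w. u = s + w" if u: "u \<in> Poly_Mapping.keys (g * f)" for u
    proof -
      obtain a c where "u = a + c" "c \<in> Poly_Mapping.keys f"
        using u keys_mult[of g f] by blast
      moreover from this obtain s w where "s \<in> S" "c = s + w"
        using f by blast
      ultimately have "u = s + (a + w)"
        by (simp add: ac_simps)
      with \<open>s \<in> S\<close> show ?thesis
        by blast
    qed
    then show "g * f \<in> ?J"
      using f g by (auto simp: mult_closed_poly_ring)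
  qed (auto simp: carrier_poly_ring)
  moreover have "monom ` S \<subseteq> ?J"
    using assms(2) by (auto simp: monom_closed_poly_ring intro!: bexI exI[of _ 0])
  ultimately have "genideal (poly_ring d) (monom ` S) \<subseteq> ?J"
    by (rule ring.genideal_minimal[OF ring_poly_ring])
  with assms(1,3) show ?thesis
    by blast
qed

section \<open>Term orders and reduced Groebner bases\<close>

lemma term_orderD:
  assumes "term_order d gr"
  shows "u \<in> monomials d \<Longrightarrow> \<not> gr u u"
    and "u \<in> monomials d \<Longrightarrow> v \<in> monomials d \<Longrightarrow> w \<in> monomials d \<Longrightarrow> gr u v \<Longrightarrow> gr v w \<Longrightarrow> gr u w"
    and "u \<in> monomials d \<Longrightarrow> v \<in> monomials d \<Longrightarrow> u \<noteq> v \<Longrightarrow> gr u v \<or> gr v u"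
    and "u \<in> monomials d \<Longrightarrow> u \<noteq> 0 \<Longrightarrow> gr u 0"
    and "u \<in> monomials d \<Longrightarrow> v \<in> monomials d \<Longrightarrow> w \<in> monomials d \<Longrightarrow> gr u v \<Longrightarrow> gr (u + w) (v + w)"
  using assms unfolding term_order_def irreflp_on_def transp_on_def totalp_on_def
  by blast+

lemma term_order_add:
  assumes "term_order d gr" "u + w \<in> monomials d" "w \<noteq> 0"
  shows "gr (u + w) u"
proof -
  have "u \<in> monomials d" "w \<in> monomials d"
    using assms(2) by (auto dest: monomials_addD)
  then show ?thesis
    using term_orderD(5)[OF assms(1), of w 0 u] term_orderD(4)[OF assms(1), of w] assms(3)
    by (simp add: add.commute)
qed

lemma term_order_asym:
  assumes "term_order d gr" "u \<in> monomials d" "v \<in> monomials d" "gr u v"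
  shows "\<not> gr v u"
  using term_orderD(1,2)[OF assms(1)] assms(2-4) by blast

lemma term_order_greatest:
  assumes "term_order d gr" "finite A" "A \<noteq> {}" "A \<subseteq> monomials d"
  shows "\<exists>u\<in>A. \<forall>v\<in>A. v \<noteq> u \<longrightarrow> gr u v"
  using assms(2-4)
proof (induction A rule: finite_ne_induct)
  case (insert x A)
  then obtain u where u: "u \<in> A" "\<forall>v\<in>A. v \<noteq> u \<longrightarrow> gr u v"
    by auto
  have mem: "x \<in> monomials d" "u \<in> monomials d" "A \<subseteq> monomials d"
    using insert.prems u by auto
  have "x \<noteq> u"
    using u insert.hyps by auto
  then consider "gr x u" | "gr u x"
    using term_orderD(3)[OF assms(1)] mem by blast
  then show ?case
  proof cases
    case 1
    then have "\<forall>v\<in>insert x A. v \<noteq> x \<longrightarrow> gr x v"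
      using term_orderD(2)[OF assms(1)] mem u by (metis insert_iff subset_iff)
    then show ?thesis by blast
  next
    case 2
    then show ?thesis using u by auto
  qed
qed simp

lemma lead_monomial_eqI:
  assumes "term_order d gr" "Poly_Mapping.keys f \<subseteq> monomials d"
    and "u \<in> Poly_Mapping.keys f" "\<And>v. v \<in> Poly_Mapping.keys f \<Longrightarrow> v \<noteq> u \<Longrightarrow> gr u v"
  shows "lead_monomial gr f = u"
  unfolding lead_monomial_def
proof (rule the_equality)
  fix v assume v: "v \<in> Poly_Mapping.keys f \<and> (\<forall>w\<in>Poly_Mapping.keys f. w \<noteq> v \<longrightarrow> gr v w)"
  show "v = u"
  proof (rule ccontr)
    assume "v \<noteq> u"
    then have "gr u v" "gr v u"
      using v assms(3,4) by auto
    then show False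
      using term_order_asym[OF assms(1)] assms(2,3) v by blast
  qed
qed (use assms in blast)

lemma
  assumes "term_order d gr" "f \<in> carrier (poly_ring d)" "f \<noteq> 0"
  shows lead_monomial_in_keys: "lead_monomial gr f \<in> Poly_Mapping.keys f"
    and lead_monomial_greatest:
      "v \<in> Poly_Mapping.keys f \<Longrightarrow> v \<noteq> lead_monomial gr f \<Longrightarrow> gr (lead_monomial gr f) v"
proof -
  have sub: "Poly_Mapping.keys f \<subseteq> monomials d"
    using assms(2) by (simp add: carrier_poly_ring)
  obtain u where u: "u \<in> Poly_Mapping.keys f" "\<forall>v\<in>Poly_Mapping.keys f. v \<noteq> u \<longrightarrow> gr u v"
    using term_order_greatest[OF assms(1) _ _ sub] assms(3) by auto
  then have "lead_monomial gr f = u"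
    using lead_monomial_eqI[OF assms(1) sub] by blast
  with u show "lead_monomial gr f \<in> Poly_Mapping.keys f"
    and "v \<in> Poly_Mapping.keys f \<Longrightarrow> v \<noteq> lead_monomial gr f \<Longrightarrow> gr (lead_monomial gr f) v"
    by auto
qed

lemma lead_monomial_in_monomials:
  assumes "term_order d gr" "f \<in> carrier (poly_ring d)" "f \<noteq> 0"
  shows "lead_monomial gr f \<in> monomials d"
  using lead_monomial_in_keys[OF assms] assms(2) by (auto simp: carrier_poly_ring)

text \<open>A proper multiple of the leading monomial would be greater than it.\<close>

lemma lead_monomial_no_multiple:
  assumes "term_order d gr" "f \<in> carrier (poly_ring d)" "f \<noteq> 0"
    and "lead_monomial gr f + w \<in> Poly_Mapping.keys f"
  shows "w = 0"
proof (rule ccontr)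
  assume w: "w \<noteq> 0"
  have mem: "lead_monomial gr f + w \<in> monomials d"
    using assms(2,4) by (auto simp: carrier_poly_ring)
  have "gr (lead_monomial gr f) (lead_monomial gr f + w)"
    using lead_monomial_greatest[OF assms(1-4)] w by simp
  moreover have "gr (lead_monomial gr f + w) (lead_monomial gr f)"
    using term_order_add[OF assms(1) mem w] .
  ultimately show False
    using term_order_asym[OF assms(1)] mem lead_monomial_in_monomials[OF assms(1-3)] by blast
qed

lemma initial_ideal_eq:
  "initial_ideal d gr S = genideal (poly_ring d) (monom ` lead_monomial gr ` (S - {0}))"
  unfolding initial_ideal_def by (rule arg_cong[where f = "genideal _"]) auto

lemma groebner_basis_lead_divides:
  fixes I :: "'k::field polynomial set"
  assumes "term_order d gr" "I \<subseteq> carrier (poly_ring d)" "groebner_basis d gr I G"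
    and "f \<in> I" "f \<noteq> 0"
  shows "\<exists>g\<in>G. g \<noteq> 0 \<and> (\<exists>w. lead_monomial gr f = lead_monomial gr g + w)"
proof -
  have G: "G \<subseteq> I" and eq: "initial_ideal d gr G = initial_ideal d gr I"
    using assms(3) by (auto simp: groebner_basis_def)
  have sub: "lead_monomial gr ` (S - {0}) \<subseteq> monomials d" if "S \<subseteq> I" for S
    using that lead_monomial_in_monomials[OF assms(1)] assms(2) by blast
  have "monom (lead_monomial gr f) \<in> initial_ideal d gr I"
    unfolding initial_ideal_eq
    by (rule subsetD[OF ring.genideal_self[OF ring_poly_ring]])
      (use sub[of I] assms(4,5) in \<open>auto simp: monom_closed_poly_ring\<close>)
  then have "monom (lead_monomial gr f) \<in>
      genideal (poly_ring d) (monom ` lead_monomial gr ` (G - {0}) :: 'k polynomial set)"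
    using eq by (simp add: initial_ideal_eq)
  from monomial_ideal_divides[OF this sub[OF G], of "lead_monomial gr f"]
  show ?thesis by auto
qed

text \<open>Divisibility passes from a leading monomial of \<open>G\<close> to one of
  \<open>G'\<close> and back to one of \<open>G\<close>; reducedness closes this loop, so
  \<open>g\<close> and some \<open>g'\<close> share their leading monomial. A nonzero
  \<open>g - g'\<close> would then have a leading monomial occurring in \<open>g\<close> or
  \<open>g'\<close> below the common one, yet divisible by a leading monomial of either basis,
  against reducedness.\<close>

lemma reduced_groebner_basis_subset:
  assumes "term_order d gr" "ideal I (poly_ring d)"
    and "reduced_groebner_basis d gr I G" "reduced_groebner_basis d gr I G'"
  shows "G \<subseteq> G'"
proof
  let ?lm = "lead_monomial gr"
  interpret I: ideal I "poly_ring d"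
    by (rule assms(2))
  have Ic: "I \<subseteq> carrier (poly_ring d)"
    using I.a_subset .
  have gb: "groebner_basis d gr I G" "groebner_basis d gr I G'"
    using assms(3,4) by (auto simp: reduced_groebner_basis_def)
  then have sub: "G \<subseteq> I" "G' \<subseteq> I"
    by (auto simp: groebner_basis_def)
  note div = gb[THEN groebner_basis_lead_divides[OF assms(1) Ic]]
  have nz: "g \<noteq> 0" and one: "Poly_Mapping.lookup g (?lm g) = 1" if "g \<in> G \<union> G'" for g
    using that assms(3,4) by (auto simp: reduced_groebner_basis_def)
  have red: "g = h" if "g \<in> K" "h \<in> K" "K = G \<or> K = G'" "?lm g + w \<in> Poly_Mapping.keys h" for g h w K
    using that assms(3,4) unfolding reduced_groebner_basis_def by metis
  fix g assume g: "g \<in> G"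
  obtain g' w where g': "g' \<in> G'" "?lm g = ?lm g' + w"
    using div(2)[of g] g sub nz by auto
  obtain g'' w' where g'': "g'' \<in> G" "?lm g' = ?lm g'' + w'"
    using div(1)[of g'] g' sub nz by auto
  have car: "g \<in> carrier (poly_ring d)" "g' \<in> carrier (poly_ring d)"
    using g g' sub Ic by auto
  have "?lm g = ?lm g'' + (w' + w)"
    using g' g'' by (simp add: ac_simps)
  moreover have "?lm g \<in> Poly_Mapping.keys g"
    using lead_monomial_in_keys[OF assms(1)] car nz g by blast
  ultimately have eq: "g'' = g" "?lm g = ?lm g + (w' + w)"
    using red[OF g''(1) g, of "w' + w"] by auto
  then have "w' + w = 0"
    by (metis add_cancel_left_right)
  \<comment> \<open>Exponents are natural numbers, so a vanishing sum has vanishing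
    summands.\<close>
  then have "w = 0"
    by (intro poly_mapping_eqI) (metis add_is_0 lookup_add lookup_zero)
  then have lm: "?lm g' = ?lm g"
    using g' by simp
  have "g = g'"
  proof (rule ccontr)
    assume "g \<noteq> g'"
    then have ne: "g - g' \<noteq> 0" by simp
    have mem: "g - g' \<in> I"
      using ideal_poly_ring_diff[OF assms(2)] g g' sub by blast
    let ?u = "?lm (g - g')"
    have "?u \<in> Poly_Mapping.keys (g - g')"
      using lead_monomial_in_keys[OF assms(1) _ ne] mem Ic by blast
    \<comment> \<open>Both leading coefficients are 1, so the common leading monomial cancels in the
      difference.\<close>
    then have u: "?u \<in> Poly_Mapping.keys g \<union> Poly_Mapping.keys g'" "?u \<noteq> ?lm g"
      using keys_diff[of g g'] one[of g] one[of g'] g g'(1) lm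
      by (blast, auto simp: in_keys_iff lookup_minus)
    \<comment> \<open>Stated for either basis \<open>K\<close>, since \<open>?u\<close> may come
      from \<open>g\<close> or from \<open>g'\<close>. Reducedness gives \<open>h = k\<close>, and
      then \<open>?u\<close> is a multiple of the leading monomial of \<open>k\<close> inside
      \<open>k\<close>, hence that monomial itself.\<close>
    have no: False if "h \<in> K" "k \<in> K" "K = G \<or> K = G'" "?lm k = ?lm g"
      "?u = ?lm h + x" "?u \<in> Poly_Mapping.keys k" for h k K x
    proof -
      have "h = k"
        using red[OF that(1-3), of x] that(5,6) by simp
      moreover have "k \<in> I" "k \<noteq> 0"
        using that(2,3) sub nz by auto
      ultimately have "x = 0"
        using lead_monomial_no_multiple[OF assms(1), of k x] that(5,6) Ic by auto
      then show False
        using \<open>h = k\<close> that(4,5) u(2) by simp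
    qed
    obtain h x where "h \<in> G" "?u = ?lm h + x"
      using div(1)[OF mem ne] by blast
    moreover obtain h' x' where "h' \<in> G'" "?u = ?lm h' + x'"
      using div(2)[OF mem ne] by blast
    ultimately show False
      using u(1) no[of h G g x] no[of h' G' g' x'] g g'(1) lm by blast
  qed
  with g' show "g \<in> G'"
    by simp
qed

lemma reduced_groebner_basis_unique:
  assumes "term_order d gr" "ideal I (poly_ring d)"
    and "reduced_groebner_basis d gr I G" "reduced_groebner_basis d gr I G'"
  shows "G = G'"
  using reduced_groebner_basis_subset[OF assms] reduced_groebner_basis_subset[OF assms(1,2,4,3)]
  by (rule subset_antisym)

lemma groebner_basisI:
  fixes I :: "'k::field polynomial set"
  assumes "term_order d gr" "I \<subseteq> carrier (poly_ring d)" "finite G" "G \<subseteq> I"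
    and "\<And>f. f \<in> I \<Longrightarrow> f \<noteq> 0 \<Longrightarrow> \<exists>g\<in>G. g \<noteq> 0 \<and> (\<exists>w. lead_monomial gr f = lead_monomial gr g + w)"
  shows "groebner_basis d gr I G"
proof -
  let ?L = "\<lambda>S. monom ` lead_monomial gr ` (S - {0}) :: 'k polynomial set"
  have sub: "?L S \<subseteq> carrier (poly_ring d)" if "S \<subseteq> I" for S
  proof
    fix x assume "x \<in> ?L S"
    then obtain f where f: "x = monom (lead_monomial gr f)" "f \<in> S" "f \<noteq> 0"
      by blast
    then have "lead_monomial gr f \<in> monomials d"
      using that lead_monomial_in_monomials[OF assms(1)] assms(2) by blast
    with f show "x \<in> carrier (poly_ring d)"
      by (simp add: monom_closed_poly_ring)
  qed
  interpret R: ring "poly_ring d :: 'k polynomial ring"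
    by (rule ring_poly_ring)
  interpret J: ideal "genideal (poly_ring d) (?L G)" "poly_ring d"
    by (rule R.genideal_ideal[OF sub[OF assms(4)]])
  have "?L I \<subseteq> genideal (poly_ring d) (?L G)"
  proof
    fix x assume "x \<in> ?L I"
    then obtain f where f: "x = monom (lead_monomial gr f)" "f \<in> I" "f \<noteq> 0"
      by blast
    then obtain g w where g: "g \<in> G" "g \<noteq> 0" "lead_monomial gr f = lead_monomial gr g + w"
      using assms(5) by blast
    have "lead_monomial gr f \<in> monomials d"
      using lead_monomial_in_monomials[OF assms(1)] f assms(2) by blast
    then have "monom w \<in> carrier (poly_ring d)"
      using g(3) monomials_addD(2)[of _ w d] by (simp add: monom_closed_poly_ring)
    moreover have "monom (lead_monomial gr g) \<in> genideal (poly_ring d) (?L G)"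
      using R.genideal_self[OF sub[OF assms(4)]] g by blast
    ultimately show "x \<in> genideal (poly_ring d) (?L G)"
      using J.I_r_closed by (simp add: f(1) g(3) monom_add)
  qed
  then have "genideal (poly_ring d) (?L I) \<subseteq> genideal (poly_ring d) (?L G)"
    by (rule R.genideal_minimal[OF J.is_ideal])
  moreover have "genideal (poly_ring d) (?L G) \<subseteq> genideal (poly_ring d) (?L I)"
    by (rule R.subset_Idl_subset[OF sub[OF subset_refl]])
      (use assms(4) R.genideal_self[OF sub[OF subset_refl]] in blast)
  ultimately show ?thesis
    using assms(3,4) unfolding groebner_basis_def initial_ideal_eq by blast
qed

section \<open>Refining a term order by non-negative weights\<close>

lemma weight_add: "weight d b (u + v) = weight d b u + weight d b v"
  by (simp add: weight_def lookup_add algebra_simps sum.distrib)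

lemma weight_nonneg: "(\<And>e. e \<in> arcs d \<Longrightarrow> b e \<ge> 0) \<Longrightarrow> weight d b u \<ge> 0"
  by (auto simp: weight_def intro!: sum_nonneg)

text \<open>Non-negative weights keep the monomial 1 least; the other axioms follow from additivity
  of the weight and those of \<open>gr\<close>.\<close>

lemma term_order_refinement:
  assumes "term_order d gr" "\<And>e. e \<in> arcs d \<Longrightarrow> b e \<ge> 0"
  shows "term_order d (refinement d b gr)"
proof -
  have w0: "weight d b 0 = 0"
    by (simp add: weight_def)
  have nn: "weight d b u \<ge> 0" for u
    by (rule weight_nonneg) (rule assms(2))
  note gr = term_orderD[OF assms(1)]
  show ?thesis
    unfolding term_order_def
  proof (intro conjI ballI impI)
    show "irreflp_on (monomials d) (refinement d b gr)"
      using gr(1) by (auto simp: irreflp_on_def refinement_def)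
    show "transp_on (monomials d) (refinement d b gr)"
      unfolding transp_on_def refinement_def using gr(2) by (smt (verit))
    show "totalp_on (monomials d) (refinement d b gr)"
      unfolding totalp_on_def refinement_def using gr(3) by (smt (verit))
    show "refinement d b gr u 0" if "u \<in> monomials d" "u \<noteq> 0" for u
      using gr(4)[OF that] nn[of u] by (auto simp: refinement_def w0)
    show "refinement d b gr (u + w) (v + w)"
      if "u \<in> monomials d" "v \<in> monomials d" "w \<in> monomials d" "refinement d b gr u v" for u v w
      using gr(5)[OF that(1-3)] that(4) by (auto simp: refinement_def weight_add)
  qed
qed

section \<open>The kernel of H consists of potential differences\<close>

lemma finite_arcs: "finite (arcs d)"
proof (rule finite_subset)
  show "arcs d \<subseteq> {..d} \<times> {..d}"
    by (auto simp: arcs_def)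
qed simp

lemma H_row_sum:
  fixes x :: "arc \<Rightarrow> int"
  assumes "(k, l) \<in> H_rows d"
  shows "(\<Sum>e\<in>arcs d. H_entry (k, l) e * x e) = x (k, l) - (\<Sum>j\<in>{k..<l}. x (j, j + 1))"
proof -
  let ?B = "(\<lambda>j. (j, j + 1)) ` {k..<l}"
  have kl: "(k, l) \<in> arcs d" "l > k + 1" and sub: "?B \<subseteq> arcs d"
    using assms by (auto simp: H_rows_def arcs_def)
  \<comment> \<open>Because \<open>l > k + 1\<close>, the arc \<open>(k, l)\<close> lies outside
    \<open>?B\<close>, so the case distinction in \<open>H_entry\<close> is a difference of two
    indicators.\<close>
  have "H_entry (k, l) e * x e = (if e = (k, l) then x e else 0) - (if e \<in> ?B then x e else 0)" for e
    using kl(2) by (auto simp: H_entry_def)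
  then have "(\<Sum>e\<in>arcs d. H_entry (k, l) e * x e) =
      (\<Sum>e\<in>arcs d. if e = (k, l) then x e else 0) - (\<Sum>e\<in>arcs d. if e \<in> ?B then x e else 0)"
    by (simp add: sum_subtractf)
  also have "(\<Sum>e\<in>arcs d. if e = (k, l) then x e else 0) = x (k, l)"
    using kl(1) finite_arcs by simp
  also have "(\<Sum>e\<in>arcs d. if e \<in> ?B then x e else 0) = sum x ?B"
    using sum.inter_restrict[OF finite_arcs, of x d ?B] sub by (simp add: Int_absorb1)
  also have "sum x ?B = (\<Sum>j\<in>{k..<l}. x (j, j + 1))"
    by (subst sum.reindex) (auto simp: inj_on_def)
  finally show ?thesis .
qed

text \<open>The vector \<open>H u\<close>, padded by 0 off the rows: equality of functions becomes
  agreement under \<open>H\<close>, and the values form an abelian group under pointwise addition,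
  as fiber sums require.\<close>

definition H_image :: "nat \<Rightarrow> monomial \<Rightarrow> arc \<Rightarrow> int" where
  "H_image d u r =
     (if r \<in> H_rows d then \<Sum>e\<in>arcs d. H_entry r e * int (Poly_Mapping.lookup u e) else 0)"

lemma H_image_add: "H_image d (u + v) = H_image d u + H_image d v"
  by (rule ext) (simp add: H_image_def lookup_add sum.distrib algebra_simps)

lemma H_image_eq_iff:
  "H_image d u = H_image d v \<longleftrightarrow>
     (\<forall>r\<in>H_rows d. (\<Sum>e\<in>arcs d. H_entry r e * int (Poly_Mapping.lookup u e)) =
                   (\<Sum>e\<in>arcs d. H_entry r e * int (Poly_Mapping.lookup v e)))"
  by (auto simp: H_image_def fun_eq_iff)

text \<open>A row \<open>(k, l)\<close> says that the difference on a long arc is the sum of those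
  on the consecutive arcs below it. Partial sums from vertex 1 give the potential: consecutive arcs
  fit by construction, long arcs by the rows of \<open>H\<close>. Conversely, potential differences
  telescope.\<close>

lemma H_image_eq_iff_potential:
  "H_image d u = H_image d v \<longleftrightarrow>
     (\<exists>p :: nat \<Rightarrow> int. \<forall>(j, k)\<in>arcs d.
        int (Poly_Mapping.lookup u (j, k)) - int (Poly_Mapping.lookup v (j, k)) = p k - p j)"
    (is "?L \<longleftrightarrow> ?R")
proof -
  define x where "x = (\<lambda>e. int (Poly_Mapping.lookup u e) - int (Poly_Mapping.lookup v e))"
  have row: "?L \<longleftrightarrow> (\<forall>(k, l)\<in>H_rows d. x (k, l) = (\<Sum>j\<in>{k..<l}. x (j, j + 1)))"
    unfolding H_image_eq_iff
    by (intro ball_cong refl) (auto simp: H_row_sum x_def sum_subtractf)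
  show ?thesis
  proof
    assume L: ?L
    define p where "p k = (\<Sum>j\<in>{1..<k}. x (j, j + 1))" for k
    have "x (j, k) = p k - p j" if jk: "(j, k) \<in> arcs d" for j k
    proof -
      have "1 \<le> j" "j < k"
        using jk by (auto simp: arcs_def)
      then have "p k - p j = (\<Sum>i\<in>{j..<k}. x (i, i + 1))"
        unfolding p_def using sum.atLeastLessThan_concat[of 1 j k "\<lambda>i. x (i, i + 1)"] by simp
      also have "\<dots> = x (j, k)"
      proof (cases "k = j + 1")
        case False
        then have "(j, k) \<in> H_rows d"
          using jk \<open>j < k\<close> by (auto simp: H_rows_def)
        with L show ?thesis
          unfolding row by auto
      qed simp
      finally show ?thesis ..
    qed
    then show ?R
      by (auto simp: x_def)
  next
    assume ?R
    then obtain p where p: "\<And>j k. (j, k) \<in> arcs d \<Longrightarrow> x (j, k) = p k - p j"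
      unfolding x_def by fast
    have "x (k, l) = (\<Sum>j\<in>{k..<l}. x (j, j + 1))" if kl: "(k, l) \<in> H_rows d" for k l
    proof -
      have "(\<Sum>j\<in>{k..<l}. x (j, j + 1)) = (\<Sum>j\<in>{k..<l}. p (Suc j) - p j)"
        using kl by (intro sum.cong refl) (auto simp: p H_rows_def arcs_def)
      also have "\<dots> = p l - p k"
        using kl by (intro sum_Suc_diff') (auto simp: H_rows_def)
      also have "\<dots> = x (k, l)"
        using kl by (auto simp: p H_rows_def)
      finally show ?thesis ..
    qed
    then show ?L
      unfolding row by blast
  qed
qed

lemma toric_ideal_eq:
  "toric_ideal d = genideal (poly_ring d)
     {monom u - monom v | u v. u \<in> monomials d \<and> v \<in> monomials d \<and> H_image d u = H_image d v}"
  unfolding toric_ideal_def H_image_eq_iff ..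

lemma toric_generators_closed:
  "{monom u - monom v | u v. u \<in> monomials d \<and> v \<in> monomials d \<and> H_image d u = H_image d v}
     \<subseteq> carrier (poly_ring d :: 'k::field polynomial ring)"
proof clarify
  fix u v assume "u \<in> monomials d" "v \<in> monomials d"
  then show "monom u - monom v \<in> carrier (poly_ring d :: 'k polynomial ring)"
    using keys_diff[of "monom u :: 'k polynomial" "monom v"] by (auto simp: carrier_poly_ring)
qed

lemma ideal_toric_ideal: "ideal (toric_ideal d :: 'k::field polynomial set) (poly_ring d)"
  unfolding toric_ideal_eq
  by (rule ring.genideal_ideal[OF ring_poly_ring toric_generators_closed])

lemma toric_ideal_closed: "toric_ideal d \<subseteq> carrier (poly_ring d :: 'k::field polynomial ring)"
  using ideal_toric_ideal by (rule additive_subgroup.a_subset[OF ideal.axioms(1)])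

lemma binomial_in_toric_ideal:
  assumes "u \<in> monomials d" "v \<in> monomials d" "H_image d u = H_image d v"
  shows "monom u - monom v \<in> (toric_ideal d :: 'k::field polynomial set)"
  unfolding toric_ideal_eq
  using ring.genideal_self[OF ring_poly_ring toric_generators_closed] assms by blast

text \<open>In a generator both monomials lie in one fiber, where their coefficients cancel; the
  polynomials with this property form an ideal.\<close>

lemma fiber_sum_toric_ideal:
  assumes "f \<in> (toric_ideal d :: 'k::field polynomial set)"
  shows "fiber_sum (H_image d) c f = 0"
proof -
  let ?J = "{f :: 'k polynomial. f \<in> carrier (poly_ring d) \<and> (\<forall>c. fiber_sum (H_image d) c f = 0)}"
  have "ideal ?J (poly_ring d)"
    by (rule ideal_poly_ringI)
      (auto simp: add_closed_poly_ring mult_closed_poly_ring fiber_sum_add carrier_poly_ring[of 0]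
        intro: fiber_sum_mult_eq_0 H_image_add)
  moreover have "{monom u - monom v | u v. u \<in> monomials d \<and> v \<in> monomials d \<and>
      H_image d u = H_image d v} \<subseteq> ?J"
    using toric_generators_closed[of d, where 'k = 'k]
    by (auto simp: fiber_sum_diff monom_def)
  ultimately have "toric_ideal d \<subseteq> ?J"
    unfolding toric_ideal_eq by (rule ring.genideal_minimal[OF ring_poly_ring])
  with assms show ?thesis
    by blast
qed

section \<open>The leading monomials\<close>

definition in_exp :: "nat \<Rightarrow> monomial" where
  "in_exp i = (\<Sum>j\<in>{1..<i}. Poly_Mapping.single (j, i) 1)"

text \<open>For \<open>i = d\<close> this is 0, the exponent of the empty product.\<close>

definition out_exp :: "nat \<Rightarrow> nat \<Rightarrow> monomial" where
  "out_exp d i = (\<Sum>k\<in>{i<..d}. Poly_Mapping.single (i, k) 1)"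

lemma lookup_in_exp:
  "Poly_Mapping.lookup (in_exp i) (j, k) = (if k = i \<and> 1 \<le> j \<and> j < i then 1 else 0)"
  unfolding in_exp_def
  by (cases "k = i") (auto simp: lookup_sum lookup_single when_def)

lemma lookup_out_exp:
  "Poly_Mapping.lookup (out_exp d i) (j, k) = (if j = i \<and> i < k \<and> k \<le> d then 1 else 0)"
  unfolding out_exp_def
  by (cases "j = i") (auto simp: lookup_sum lookup_single when_def)

lemma in_exp_monomials: "i \<le> d \<Longrightarrow> in_exp i \<in> monomials d"
  by (auto simp: monomials_def arcs_def in_keys_iff lookup_in_exp split: if_splits)

lemma out_exp_monomials: "1 \<le> i \<Longrightarrow> out_exp d i \<in> monomials d"
  by (auto simp: monomials_def arcs_def in_keys_iff lookup_out_exp split: if_splits)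

lemma in_exp_dividesI:
  assumes "\<And>j. 1 \<le> j \<Longrightarrow> j < i \<Longrightarrow> Poly_Mapping.lookup u (j, i) \<ge> 1"
  shows "\<exists>w. u = in_exp i + w"
proof
  \<comment> \<open>Subtraction is truncated pointwise; the assumption ensures that nothing is cut
    off.\<close>
  show "u = in_exp i + (u - in_exp i)"
  proof (rule poly_mapping_eqI)
    fix e :: arc
    show "Poly_Mapping.lookup u e = Poly_Mapping.lookup (in_exp i + (u - in_exp i)) e"
      using assms by (cases e) (auto simp: lookup_add lookup_minus lookup_in_exp)
  qed
qed

text \<open>The arc \<open>(1, k)\<close> serves as a probe: it enters \<open>k\<close> because
  \<open>k \<ge> 2\<close>, and it occurs in no other \<open>in_exp i\<close>.\<close>

lemma in_exp_divides_in_exp: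
  assumes "in_exp i = in_exp k + w" "2 \<le> k"
  shows "i = k"
  using arg_cong[OF assms(1), of "\<lambda>u. Poly_Mapping.lookup u (1, k)"] assms(2)
  by (auto simp: lookup_add lookup_in_exp split: if_splits)

lemma in_exp_not_divides_out_exp:
  assumes "2 \<le> i" "2 \<le> k"
  shows "out_exp d i \<noteq> in_exp k + w"
proof
  assume "out_exp d i = in_exp k + w"
  from arg_cong[OF this, of "\<lambda>u. Poly_Mapping.lookup u (1, k)"] assms show False
    by (auto simp: lookup_add lookup_in_exp lookup_out_exp)
qed

text \<open>The potential here is the indicator function of the vertex \<open>i\<close>.\<close>
lemma H_image_in_exp_out_exp: "H_image d (in_exp i) = H_image d (out_exp d i)"
  unfolding H_image_eq_iff_potential
  by (rule exI[of _ "\<lambda>j. if j = i then 1 else 0"])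
    (auto simp: arcs_def lookup_in_exp lookup_out_exp)

section \<open>The binomials as polynomials\<close>

lemma prod_var:
  "finite A \<Longrightarrow> (\<Prod>a\<in>A. var (h a)) = (monom (\<Sum>a\<in>A. Poly_Mapping.single (h a) 1) :: 'k::field polynomial)"
proof (induction A rule: finite_induct)
  case empty
  then show ?case
    by (simp add: monom_def)
qed (simp add: var_def monom_add)

lemma g_poly_eq: "g_poly d i = (monom (in_exp i) - monom (out_exp d i) :: 'k::field polynomial)"
  by (simp add: g_poly_def in_exp_def out_exp_def prod_var)

lemma g_poly_in_toric_ideal:
  "2 \<le> i \<Longrightarrow> i \<le> d \<Longrightarrow> g_poly d i \<in> (toric_ideal d :: 'k::field polynomial set)"
  unfolding g_poly_eq
  by (intro binomial_in_toric_ideal in_exp_monomials out_exp_monomials H_image_in_exp_out_exp) auto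

lemma in_exp_neq_out_exp: "2 \<le> i \<Longrightarrow> in_exp i \<noteq> out_exp d i"
  using in_exp_not_divides_out_exp[of i i d 0] by auto

lemma keys_g_poly:
  assumes "2 \<le> i"
  shows "Poly_Mapping.keys (g_poly d i :: 'k::field polynomial) = {in_exp i, out_exp d i}"
  using in_exp_neq_out_exp[OF assms, of d]
  by (auto simp: g_poly_eq monom_def in_keys_iff lookup_minus lookup_single when_def split: if_splits)

lemma lookup_g_poly_in_exp:
  assumes "2 \<le> i"
  shows "Poly_Mapping.lookup (g_poly d i :: 'k::field polynomial) (in_exp i) = 1"
  using in_exp_neq_out_exp[OF assms, of d]
  by (simp add: g_poly_eq monom_def lookup_minus lookup_single when_def)

section \<open>Weights of potential differences\<close>

text \<open>Abel summation, which turns weights of differences of \<open>p\<close> into values of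
  \<open>p\<close> itself; for decreasing \<beta> the coefficients in the sum are positive.\<close>

lemma summation_by_parts:
  fixes \<beta> p :: "nat \<Rightarrow> real"
  assumes "n \<ge> 1" "p 1 = 0"
  shows "(\<Sum>j\<in>{1..n}. \<beta> j * (p (j + 1) - p j)) =
    \<beta> n * p (n + 1) + (\<Sum>j\<in>{2..n}. (\<beta> (j - 1) - \<beta> j) * p j)"
  using assms(1)
proof (induction n rule: nat_induct_at_least)
  case base
  then show ?case using assms(2) by simp
next
  case (Suc n)
  then show ?case by (simp add: algebra_simps)
qed

lemma weight_eq_consecutive:
  assumes "\<And>i j. (i, j) \<in> arcs d \<Longrightarrow> j > i + 1 \<Longrightarrow> b (i, j) = 0"
  shows "weight d b u = (\<Sum>j\<in>{1..d - 1}. b (j, j + 1) * real (Poly_Mapping.lookup u (j, j + 1)))"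
proof -
  let ?B = "(\<lambda>j. (j, j + 1)) ` {1..d - 1}"
  have "weight d b u = (\<Sum>e\<in>?B. b e * real (Poly_Mapping.lookup u e))"
    unfolding weight_def
  proof (rule sum.mono_neutral_right[OF finite_arcs])
    show "?B \<subseteq> arcs d"
      by (auto simp: arcs_def)
    show "\<forall>e\<in>arcs d - ?B. b e * real (Poly_Mapping.lookup u e) = 0"
    proof
      fix e assume e: "e \<in> arcs d - ?B"
      obtain i j where ij: "e = (i, j)"
        by (cases e)
      have "j \<noteq> i + 1"
      proof
        assume "j = i + 1"
        then have "e = (i, i + 1)" "i \<in> {1..d - 1}"
          using e ij by (auto simp: arcs_def)
        then show False
          using e by blast
      qed
      then have "j > i + 1"
        using e ij by (auto simp: arcs_def)
      then show "b e * real (Poly_Mapping.lookup u e) = 0"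
        using assms[of i j] e ij by simp
    qed
  qed
  also have "\<dots> = (\<Sum>j\<in>{1..d - 1}. b (j, j + 1) * real (Poly_Mapping.lookup u (j, j + 1)))"
    by (subst sum.reindex) (auto simp: inj_on_def)
  finally show ?thesis .
qed

text \<open>Used both for the leading monomial of a member of the ideal with its partner and, to
  reach a contradiction, for the two terms of \<open>g_poly d i\<close>.\<close>

lemma in_exp_divides_greater:
  assumes "d \<ge> 2" "term_order d gr"
    and b0: "\<And>i j. (i, j) \<in> arcs d \<Longrightarrow> j > i + 1 \<Longrightarrow> b (i, j) = 0"
    and bpos: "b (d - 1, d) \<ge> 0"
    and bdec: "\<And>i j. 1 \<le> i \<Longrightarrow> i < j \<Longrightarrow> j \<le> d - 1 \<Longrightarrow> b (i, i + 1) > b (j, j + 1)"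
    and mem: "u \<in> monomials d" "v \<in> monomials d"
    and "H_image d u = H_image d v" "refinement d b gr u v"
  shows "\<exists>i\<in>{2..d}. \<exists>w. u = in_exp i + w"
proof -
  obtain q :: "nat \<Rightarrow> int" where q: "\<And>j k. (j, k) \<in> arcs d \<Longrightarrow>
      int (Poly_Mapping.lookup u (j, k)) - int (Poly_Mapping.lookup v (j, k)) = q k - q j"
    using assms(8) unfolding H_image_eq_iff_potential by fast
  define p where "p k = q k - q 1" for k
  have p1: "p 1 = 0"
    by (simp add: p_def)
  have p: "int (Poly_Mapping.lookup u (j, k)) - int (Poly_Mapping.lookup v (j, k)) = p k - p j"
    if "(j, k) \<in> arcs d" for j k
    using q[OF that] by (simp add: p_def)
  show ?thesis
  proof (cases "\<exists>k\<in>{1..d}. p k > 0")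
    case True
    \<comment> \<open>At the first vertex \<open>i\<close> where the potential is maximal, all arcs entering \<open>i\<close>
      have a positive potential difference.\<close>
    define M where "M = Max (p ` {1..d})"
    have M: "p k \<le> M" if "k \<in> {1..d}" for k
      using that by (simp add: M_def)
    have "M > 0"
      using True M by force
    define i where "i = (LEAST k. k \<in> {1..d} \<and> p k = M)"
    have "M \<in> p ` {1..d}"
      unfolding M_def by (rule Max_in) (use assms(1) in auto)
    then have "\<exists>k. k \<in> {1..d} \<and> p k = M"
      by blast
    then have i: "i \<in> {1..d}" "p i = M"
      unfolding i_def by (metis (mono_tags, lifting) LeastI_ex)+
    have "i \<noteq> 1"
      using i \<open>M > 0\<close> p1 by auto
    moreover have "Poly_Mapping.lookup u (j, i) \<ge> 1" if j: "1 \<le> j" "j < i" for j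
    proof -
      have "p j \<noteq> M"
        using not_less_Least[of j "\<lambda>k. k \<in> {1..d} \<and> p k = M"] j i(1) unfolding i_def by auto
      then have "p j < p i"
        using M[of j] j i by auto
      then show ?thesis
        using p[of j i] j i(1) by (auto simp: arcs_def)
    qed
    ultimately show ?thesis
      using in_exp_dividesI[of i u] i(1) by (intro bexI[of _ i]) auto
  next
    case False
    \<comment> \<open>Otherwise summation by parts shows that \<open>u\<close> has at most the weight of \<open>v\<close>, with equality
      only if the potential is supported at \<open>d\<close>; then \<open>u\<close> divides \<open>v\<close>.\<close>
    then have le0: "p k \<le> 0" if "k \<in> {1..d}" for k
      using that by (meson not_less)
    define \<beta> where "\<beta> j = b (j, j + 1)" for j
    have weight: "weight d b w =
        (\<Sum>j\<in>{1..d - 1}. \<beta> j * real (Poly_Mapping.lookup w (j, j + 1)))" for w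
      unfolding \<beta>_def by (rule weight_eq_consecutive) (rule b0)
    have "weight d b u - weight d b v =
        (\<Sum>j\<in>{1..d - 1}. \<beta> j * (real (Poly_Mapping.lookup u (j, j + 1)) - real (Poly_Mapping.lookup v (j, j + 1))))"
      unfolding weight
      by (simp add: sum_subtractf algebra_simps)
    also have "\<dots> = (\<Sum>j\<in>{1..d - 1}. \<beta> j * (real_of_int (p (j + 1)) - real_of_int (p j)))"
    proof (rule sum.cong[OF refl])
      fix j assume "j \<in> {1..d - 1}"
      then have "(j, j + 1) \<in> arcs d"
        by (auto simp: arcs_def)
      from arg_cong[OF p[OF this], of real_of_int]
      show "\<beta> j * (real (Poly_Mapping.lookup u (j, j + 1)) - real (Poly_Mapping.lookup v (j, j + 1))) =
          \<beta> j * (real_of_int (p (j + 1)) - real_of_int (p j))"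
        by simp
    qed
    also have "\<dots> = \<beta> (d - 1) * p d + (\<Sum>j\<in>{2..d - 1}. (\<beta> (j - 1) - \<beta> j) * p j)"
      using summation_by_parts[of "d - 1" "\<lambda>j. real_of_int (p j)" \<beta>] assms(1) p1 by simp
    finally have diff: "weight d b u - weight d b v =
        \<beta> (d - 1) * p d + (\<Sum>j\<in>{2..d - 1}. (\<beta> (j - 1) - \<beta> j) * p j)" .
    have "\<beta> (d - 1) * p d \<le> 0"
      using bpos le0[of d] assms(1) by (auto simp: \<beta>_def mult_nonneg_nonpos)
    moreover have \<beta>: "\<beta> (j - 1) - \<beta> j > 0" if "j \<in> {2..d - 1}" for j
      using bdec[of "j - 1" j] that by (auto simp: \<beta>_def)
    have terms: "(\<beta> (j - 1) - \<beta> j) * p j \<le> 0" if "j \<in> {2..d - 1}" for j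
      using \<beta>[OF that] le0[of j] that by (intro mult_nonneg_nonpos) auto
    then have "(\<Sum>j\<in>{2..d - 1}. (\<beta> (j - 1) - \<beta> j) * p j) \<le> 0"
      by (rule sum_nonpos)
    moreover have "weight d b u - weight d b v \<ge> 0"
      using assms(9) by (auto simp: refinement_def)
    ultimately have eq: "weight d b u = weight d b v"
      and sum0: "(\<Sum>j\<in>{2..d - 1}. (\<beta> (j - 1) - \<beta> j) * p j) = 0"
      using diff by linarith+
    \<comment> \<open>The vertex \<open>d\<close> is left out: its coefficient
      \<open>\<beta> (d - 1)\<close> may be 0, so \<open>p d\<close> may still be negative.\<close>
    have p0: "p j = 0" if "j \<in> {1..<d}" for j
    proof (cases "j = 1")
      case False
      then have j: "j \<in> {2..d - 1}"
        using that by auto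
      have "(\<beta> (j - 1) - \<beta> j) * p j = 0"
        using sum0 sum_nonneg_eq_0_iff[of "{2..d - 1}" "\<lambda>j. - ((\<beta> (j - 1) - \<beta> j) * p j)"] terms j
        by (simp add: sum_negf)
      then show ?thesis
        using \<beta>[OF j] by auto
    qed (use p1 in simp)
    \<comment> \<open>The tail \<open>j\<close> of an arc is below \<open>d\<close>, so
      \<open>p j = 0\<close> and the difference on the arc is \<open>p k \<le> 0\<close>.\<close>
    have "Poly_Mapping.lookup u e \<le> Poly_Mapping.lookup v e" for e
    proof (cases "e \<in> arcs d")
      case True
      then obtain j k where "e = (j, k)" "(j, k) \<in> arcs d" "j \<in> {1..<d}" "k \<in> {1..d}"
        by (cases e) (auto simp: arcs_def)
      then show ?thesis
        using p[of j k] p0[of j] le0[of k] by simp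
    next
      case False
      then have "e \<notin> Poly_Mapping.keys u"
        using mem(1) by (auto simp: monomials_def)
      then show ?thesis
        by (simp add: in_keys_iff)
    qed
    then have v: "v = u + (v - u)"
      by (intro poly_mapping_eqI) (simp add: lookup_add lookup_minus)
    have gr: "gr u v"
      using assms(9) eq by (simp add: refinement_def)
    then have "v - u \<noteq> 0"
      using v term_orderD(1)[OF assms(2)] mem by force
    then have "gr v u"
      using term_order_add[OF assms(2), of u "v - u"] v mem(2) by simp
    then show ?thesis
      using term_order_asym[OF assms(2)] mem gr by blast
  qed
qed

theorem theorem5p3:
  fixes d :: nat
    and b :: "nat \<times> nat \<Rightarrow> real"
    and gr :: "monomial \<Rightarrow> monomial \<Rightarrow> bool"
  assumes "d \<ge> 2"
    and "term_order d gr"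
    and "\<And>i j. (i, j) \<in> arcs d \<Longrightarrow> j > i + 1 \<Longrightarrow> b (i, j) = 0"
    and "\<exists>x :: nat \<times> nat \<Rightarrow> real. (\<forall>e\<in>arcs d. x e \<ge> 0) \<and>
           (\<forall>i\<in>{1..d - 1}. (\<Sum>e\<in>arcs d. real_of_int (F_entry i e) * x e) = b (i, i + 1))"
    and "\<And>i j. 1 \<le> i \<Longrightarrow> i < j \<Longrightarrow> j \<le> d - 1 \<Longrightarrow> b (i, i + 1) > b (j, j + 1)"
  shows "(\<forall>G :: ('k::field) polynomial set.
            reduced_groebner_basis d (refinement d b gr) (toric_ideal d) G \<longleftrightarrow>
            G = {g_poly d i | i. i \<in> {2..d}})
         \<and> card {g_poly d i :: 'k polynomial | i. i \<in> {2..d}} = d - 1"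
proof -
  let ?gr = "refinement d b gr" and ?I = "toric_ideal d :: 'k polynomial set"
  let ?g = "g_poly d :: nat \<Rightarrow> 'k polynomial"
  let ?G = "{?g i | i. i \<in> {2..d}}"
  have G: "?G = ?g ` {2..d}"
    by auto
  \<comment> \<open>The entries of \<open>F\<close> are 0 or 1, so its product with a non-negative
    vector is non-negative.\<close>
  have consec: "b (i, i + 1) \<ge> 0" if i: "i \<in> {1..d - 1}" for i
  proof -
    obtain x :: "nat \<times> nat \<Rightarrow> real" where x: "\<forall>e\<in>arcs d. x e \<ge> 0"
      "(\<Sum>e\<in>arcs d. real_of_int (F_entry i e) * x e) = b (i, i + 1)"
      using assms(4) i by blast
    have "(\<Sum>e\<in>arcs d. real_of_int (F_entry i e) * x e) \<ge> 0"
      using x(1) by (intro sum_nonneg) (auto simp: F_entry_def)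
    then show ?thesis
      using x(2) by simp
  qed
  have "b e \<ge> 0" if "e \<in> arcs d" for e
  proof -
    obtain i j where ij: "e = (i, j)" "1 \<le> i" "i < j" "j \<le> d"
      using \<open>e \<in> arcs d\<close> by (auto simp: arcs_def)
    show ?thesis
    proof (cases "j = i + 1")
      case True
      then show ?thesis
        using consec[of i] ij by auto
    next
      case False
      then show ?thesis
        using assms(3)[of i j] that ij by auto
    qed
  qed
  then have ord: "term_order d ?gr"
    by (intro term_order_refinement assms(2))
  have "b (d - 1, d) \<ge> 0"
    using consec[of "d - 1"] assms(1) by auto
  then have div: "\<exists>i\<in>{2..d}. \<exists>w. u = in_exp i + w"
    if "u \<in> monomials d" "v \<in> monomials d" "H_image d u = H_image d v" "?gr u v" for u v
    using in_exp_divides_greater[of d gr b u v] assms(1-3,5) that by blast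
  have lm: "lead_monomial ?gr (?g i) = in_exp i" if i: "i \<in> {2..d}" for i
  proof (rule lead_monomial_eqI[OF ord])
    have i2: "2 \<le> i" and mem: "in_exp i \<in> monomials d" "out_exp d i \<in> monomials d"
      using i in_exp_monomials out_exp_monomials by auto
    show "Poly_Mapping.keys (?g i) \<subseteq> monomials d" "in_exp i \<in> Poly_Mapping.keys (?g i)"
      using mem by (auto simp: keys_g_poly[OF i2])
    have "\<not> ?gr (out_exp d i) (in_exp i)"
      using div[OF mem(2,1) H_image_in_exp_out_exp[symmetric]] in_exp_not_divides_out_exp[OF i2]
      by auto
    then have "?gr (in_exp i) (out_exp d i)"
      using term_orderD(3)[OF ord mem in_exp_neq_out_exp[OF i2]] by blast
    then show "?gr (in_exp i) v" if "v \<in> Poly_Mapping.keys (?g i)" "v \<noteq> in_exp i" for v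
      using that by (auto simp: keys_g_poly[OF i2])
  qed
  have nz: "?g i \<noteq> 0" if "i \<in> {2..d}" for i
    using keys_g_poly[of i d, where 'k = 'k] that by auto
  have gb: "groebner_basis d ?gr ?I ?G"
  proof (rule groebner_basisI[OF ord toric_ideal_closed])
    show "finite ?G"
      unfolding G by simp
    show "?G \<subseteq> ?I"
      using g_poly_in_toric_ideal by auto
    fix f assume f: "f \<in> ?I" "f \<noteq> 0"
    let ?u = "lead_monomial ?gr f"
    have fc: "f \<in> carrier (poly_ring d)"
      using f(1) toric_ideal_closed by blast
    have u: "?u \<in> Poly_Mapping.keys f"
      by (rule lead_monomial_in_keys[OF ord fc f(2)])
    obtain v where v: "v \<in> Poly_Mapping.keys f" "v \<noteq> ?u" "H_image d v = H_image d ?u"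
      using fiber_sum_eq_0_partner[OF fiber_sum_toric_ideal[OF f(1)] u] .
    have "?gr ?u v"
      by (rule lead_monomial_greatest[OF ord fc f(2) v(1,2)])
    moreover have "?u \<in> monomials d" "v \<in> monomials d"
      using u v(1) fc by (auto simp: carrier_poly_ring)
    ultimately obtain i w where "i \<in> {2..d}" "?u = in_exp i + w"
      using div[of ?u v] v(3) by auto
    then show "\<exists>g\<in>?G. g \<noteq> 0 \<and> (\<exists>w. ?u = lead_monomial ?gr g + w)"
      using lm nz unfolding G by auto
  qed
  have only: "g = g'" if "g \<in> ?G" "g' \<in> ?G" "v \<in> Poly_Mapping.keys g'" "v = lead_monomial ?gr g + w"
    for g g' v w
  proof -
    obtain i k where ik: "i \<in> {2..d}" "g = ?g i" "k \<in> {2..d}" "g' = ?g k"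
      using \<open>g \<in> ?G\<close> \<open>g' \<in> ?G\<close> by auto
    \<comment> \<open>The outgoing term of \<open>?g k\<close> is a multiple of no leading monomial,
      which leaves its incoming term.\<close>
    have "v \<noteq> out_exp d k"
      using in_exp_not_divides_out_exp[of k i d w] ik that(4) lm by auto
    then have "in_exp k = in_exp i + w"
      using that(3,4) ik lm keys_g_poly[of k d, where 'k = 'k] by auto
    then show ?thesis
      using in_exp_divides_in_exp[of k i w] ik by auto
  qed
  have red: "reduced_groebner_basis d ?gr ?I ?G"
    unfolding reduced_groebner_basis_def
  proof (intro conjI ballI impI)
    show "groebner_basis d ?gr ?I ?G"
      by (rule gb)
  next
    fix g assume "g \<in> ?G"
    then obtain i where "i \<in> {2..d}" "g = ?g i"
      by auto
    then show "g \<noteq> 0" "Poly_Mapping.lookup g (lead_monomial ?gr g) = 1"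
      using nz lm lookup_g_poly_in_exp[of i d, where 'k = 'k] by auto
  next
    fix g g' v assume "g \<in> ?G" "g' \<in> ?G" "g \<noteq> g'" "v \<in> Poly_Mapping.keys g'"
    then show "\<nexists>w. v = lead_monomial ?gr g + w"
      using only by blast
  qed
  \<comment> \<open>The leading monomials already tell the binomials apart.\<close>
  have "inj_on ?g {2..d}"
  proof (rule inj_onI)
    fix i k assume "i \<in> {2..d}" "k \<in> {2..d}" "?g i = ?g k"
    then show "i = k"
      using lm[of i] lm[of k] in_exp_divides_in_exp[of i k 0] by auto
  qed
  then have "card ?G = d - 1"
    unfolding G by (simp add: card_image)
  then show ?thesis
    using red reduced_groebner_basis_unique[OF ord ideal_toric_ideal] by blast
qed

end
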